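(* There exists a sequent $(\Gamma \Rightarrow \Delta)$ that is provable in $\mathbf{IL}^-_{\mathrm{seq}}$ but cannot be proved in $\mathbf{IL}^-_{\mathrm{seq}}$ without the rule (cut).
   Context: Formulas are built from propositional variables and $\bot$ with $\neg, \land, \lor, \to$ and a binary modal operator $\rhd$; $\Box A$ abbreviates $(\neg A) \rhd \bot$, and $\Box\Gamma := \{\Box A \mid A \in \Gamma\}$. A sequent is an expression $\Gamma \Rightarrow \Delta$ with $\Gamma, \Delta$ finite sets of formulas; $\Gamma, \Delta$ means $\Gamma \cup \Delta$ and $\Gamma, A$ means $\Gamma \cup \{A\}$. The system $\mathbf{IL}^-_{\mathrm{seq}}$ has: Initial sequents: $A \Rightarrow A$ and $\bot \Rightarrow$. Logical rules: (wl) from $\Gamma \Rightarrow \Delta$ infer $\Gamma, A \Rightarrow \Delta$; (wr) from $\Gamma \Rightarrow \Delta$ infer $\Gamma \Rightarrow A, \Delta$; ($\neg$l) from $\Gamma \Rightarrow A, \Delta$ infer $\Gamma, \neg A \Rightarrow \Delta$; ($\neg$r) from $\Gamma, A \Rightarrow \Delta$ infer $\Gamma \Rightarrow \neg A, \Delta$; ($\land$l) from $\Gamma, A_i \Rightarrow \Delta$ ($i = 1$ or $2$) infer $\Gamma, A_1 \land A_2 \Rightarrow \Delta$; ($\land$r) from $\Gamma \Rightarrow A, \Delta$ and $\Gamma \Rightarrow B, \Delta$ infer $\Gamma \Rightarrow A \land B, \Delta$; ($\lor$l) from $\Gamma, A \Rightarrow \Delta$ and $\Gamma, B \Rightarrow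 \Delta$ infer $\Gamma, A \lor B \Rightarrow \Delta$; ($\lor$r) from $\Gamma \Rightarrow A_i, \Delta$ ($i=1$ or $2$) infer $\Gamma \Rightarrow A_1 \lor A_2, \Delta$; ($\to$l) from $\Gamma \Rightarrow A, \Delta$ and $\Gamma, B \Rightarrow \Delta$ infer $\Gamma, A \to B \Rightarrow \Delta$; ($\to$r) from $\Gamma, A \Rightarrow B, \Delta$ infer $\Gamma \Rightarrow A \to B, \Delta$. Cut rule: (cut) from $\Gamma \Rightarrow \Delta, A$ and $A, \Sigma \Rightarrow \Pi$ infer $\Gamma, \Sigma \Rightarrow \Delta, \Pi$. Modal rules: ($\Box$) from $\Box\Gamma, \Gamma, \Box A \Rightarrow A$ infer $\Box\Gamma \Rightarrow \Box A$; ($\rhd$) for $n \geq 0$, from $A \Rightarrow \{X_i \mid i<n\}$ and $Y_i \Rightarrow B$ for all $i<n$, infer $\{X_i \rhd Y_i \mid i<n\} \Rightarrow A \rhd B$. *)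

theory Defs
  imports Main "HOL-Library.FSet"
begin

datatype form =
    Var nat
  | Bot
  | Neg form
  | Conj form form
  | Disj form form
  | Imp form form
  | Rhd form form

abbreviation Box :: "form \<Rightarrow> form" where
  "Box A \<equiv> Rhd (Neg A) Bot"

text \<open>
  \<open>derivable c \<Gamma> \<Delta>\<close>: the sequent \<open>\<Gamma> \<Rightarrow> \<Delta>\<close> of finite sets of formulas has a derivation in which
  the cut rule may be used iff the flag \<open>c\<close> is \<open>True\<close>.  Since antecedents and succedents are sets,
  the formula introduced by a rule may already belong to its context, so contraction is implicit.
\<close>

inductive derivable :: "bool \<Rightarrow> form fset \<Rightarrow> form fset \<Rightarrow> bool" for c :: bool where
  init:  "derivable c {|A|} {|A|}"
| botL:  "derivable c {|Bot|} {||}"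
| wl:    "derivable c \<Gamma> \<Delta> \<Longrightarrow> derivable c (\<Gamma> |\<union>| {|A|}) \<Delta>"
| wr:    "derivable c \<Gamma> \<Delta> \<Longrightarrow> derivable c \<Gamma> ({|A|} |\<union>| \<Delta>)"
| negL:  "derivable c \<Gamma> ({|A|} |\<union>| \<Delta>) \<Longrightarrow> derivable c (\<Gamma> |\<union>| {|Neg A|}) \<Delta>"
| negR:  "derivable c (\<Gamma> |\<union>| {|A|}) \<Delta> \<Longrightarrow> derivable c \<Gamma> ({|Neg A|} |\<union>| \<Delta>)"
| conjL1: "derivable c (\<Gamma> |\<union>| {|A|}) \<Delta> \<Longrightarrow> derivable c (\<Gamma> |\<union>| {|Conj A B|}) \<Delta>"
| conjL2: "derivable c (\<Gamma> |\<union>| {|B|}) \<Delta> \<Longrightarrow> derivable c (\<Gamma> |\<union>| {|Conj A B|}) \<Delta>"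
| conjR: "derivable c \<Gamma> ({|A|} |\<union>| \<Delta>) \<Longrightarrow> derivable c \<Gamma> ({|B|} |\<union>| \<Delta>)
            \<Longrightarrow> derivable c \<Gamma> ({|Conj A B|} |\<union>| \<Delta>)"
| disjL: "derivable c (\<Gamma> |\<union>| {|A|}) \<Delta> \<Longrightarrow> derivable c (\<Gamma> |\<union>| {|B|}) \<Delta>
            \<Longrightarrow> derivable c (\<Gamma> |\<union>| {|Disj A B|}) \<Delta>"
| disjR1: "derivable c \<Gamma> ({|A|} |\<union>| \<Delta>) \<Longrightarrow> derivable c \<Gamma> ({|Disj A B|} |\<union>| \<Delta>)"
| disjR2: "derivable c \<Gamma> ({|B|} |\<union>| \<Delta>) \<Longrightarrow> derivable c \<Gamma> ({|Disj A B|} |\<union>| \<Delta>)"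
| impL:  "derivable c \<Gamma> ({|A|} |\<union>| \<Delta>) \<Longrightarrow> derivable c (\<Gamma> |\<union>| {|B|}) \<Delta>
            \<Longrightarrow> derivable c (\<Gamma> |\<union>| {|Imp A B|}) \<Delta>"
| impR:  "derivable c (\<Gamma> |\<union>| {|A|}) ({|B|} |\<union>| \<Delta>)
            \<Longrightarrow> derivable c \<Gamma> ({|Imp A B|} |\<union>| \<Delta>)"
| cut:   "c \<Longrightarrow> derivable c \<Gamma> (\<Delta> |\<union>| {|A|}) \<Longrightarrow> derivable c ({|A|} |\<union>| \<Sigma>) \<Pi>
            \<Longrightarrow> derivable c (\<Gamma> |\<union>| \<Sigma>) (\<Delta> |\<union>| \<Pi>)"
| box:   "derivable c (Box |`| \<Gamma> |\<union>| \<Gamma> |\<union>| {|Box A|}) {|A|}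
            \<Longrightarrow> derivable c (Box |`| \<Gamma>) {|Box A|}"
| rhd:   "derivable c {|A|} (fset_of_list (map X [0..<n]))
            \<Longrightarrow> (\<And>i. i < n \<Longrightarrow> derivable c {|Y i|} {|B|})
            \<Longrightarrow> derivable c (fset_of_list (map (\<lambda>i. Rhd (X i) (Y i)) [0..<n])) {|Rhd A B|}"

abbreviation provable :: "form fset \<Rightarrow> form fset \<Rightarrow> bool" where
  "provable \<equiv> derivable True"

abbreviation provable_without_cut :: "form fset \<Rightarrow> form fset \<Rightarrow> bool" where
  "provable_without_cut \<equiv> derivable False"

end

theory Submission
  imports Defs
begin

text \<open>
  Write \<open>\<box>\<close> for \<^term>\<open>Box\<close> and \<open>\<rhd>\<close> for \<^term>\<open>Rhd\<close>. The separating sequent is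
  \<open>p \<rhd> \<bottom> \<Rightarrow> \<box>\<box>\<not>p\<close> for a variable \<open>p\<close>. Being a box is a syntactic matter: \<open>p \<rhd> \<bottom>\<close> is not a
  box, although it is equivalent to the box \<open>\<box>\<not>p = \<not>\<not>p \<rhd> \<bottom>\<close>. The modal rule for \<open>\<rhd>\<close> turns
  the first into the second, and only then can the modal rule for \<open>\<box>\<close> add another box. A cut
  is needed to join the two steps.

  Without cut, only weakening and the modal rules can introduce the formulas of this sequent.
  The rule for \<open>\<box>\<close> has to do without \<open>p \<rhd> \<bottom>\<close>, which leaves the premise
  \<open>\<box>\<box>\<not>p \<Rightarrow> \<box>\<not>p\<close>. The rule for \<open>\<rhd>\<close> leaves the premise \<open>\<not>\<box>\<not>p \<Rightarrow> p\<close>, or the same with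
  empty succedent. None of these is derivable, because the calculus is sound for finite strict
  linear Kripke frames with \<open>A \<rhd> B\<close> read as \<open>\<box>(A \<longrightarrow> B)\<close> (\<open>soundness\<close>), and they are all
  refuted by the model in which one world, where \<open>p\<close> fails, sees a dead end, where \<open>p\<close> holds.
\<close>

text \<open>
  The worlds are the natural numbers, and a world sees the smaller ones. This order is transitive
  and conversely well-founded, so Loeb's axiom is valid. A formula \<open>A \<rhd> B\<close> holds if \<open>A\<close> implies
  \<open>B\<close> at all accessible worlds; under this reading \<^term>\<open>Box A\<close> is the usual Kripke box.
\<close>

primrec sat :: "(nat \<Rightarrow> nat \<Rightarrow> bool) \<Rightarrow> form \<Rightarrow> nat \<Rightarrow> bool" where
  "sat V (Var x) n = V x n"
| "sat V Bot n = False"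
| "sat V (Neg A) n = (\<not> sat V A n)"
| "sat V (Conj A B) n = (sat V A n \<and> sat V B n)"
| "sat V (Disj A B) n = (sat V A n \<or> sat V B n)"
| "sat V (Imp A B) n = (sat V A n \<longrightarrow> sat V B n)"
| "sat V (Rhd A B) n = (\<forall>m<n. sat V A m \<longrightarrow> sat V B m)"

lemma soundness:
  assumes "derivable c \<Gamma> \<Delta>"
    and "\<And>A. A |\<in>| \<Gamma> \<Longrightarrow> sat V A n"
  shows "\<exists>B. B |\<in>| \<Delta> \<and> sat V B n"
  using assms
proof (induction arbitrary: n rule: derivable.induct)
  case (cut \<Gamma> \<Delta> A \<Sigma> \<Pi>)
  then show ?case by (metis funion_iff fsingleton_iff)
next
  case (box \<Gamma> A)
  have hyp: "sat V C k" if "C |\<in>| \<Gamma>" "k < n" for C k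
    using box.prems[of "Box C"] that by auto
  (* Loeb's rule: strong induction on the world supplies the extra hypothesis Box A. *)
  have "m < n \<Longrightarrow> sat V A m" for m
  proof (induction m rule: less_induct)
    case (less m)
    have "\<exists>B. B |\<in>| {|A|} \<and> sat V B m"
      using hyp less by (intro box.IH) auto
    then show ?case by simp
  qed
  then show ?case by auto
next
  case (rhd A X n' Y B)
  have imp: "sat V (Y i) m" if "i < n'" "m < n" "sat V (X i) m" for i m
    using rhd.prems[of "Rhd (X i) (Y i)"] that by (auto simp: fset_of_list_elem)
  have "sat V B m" if m: "m < n" and A: "sat V A m" for m
  proof -
    obtain i where i: "i < n'" "sat V (X i) m"
      using rhd.IH(1)[of m] A by (auto simp: fset_of_list_elem)
    then show ?thesis using rhd.IH(2)[OF i(1), of m] imp[OF i(1) m i(2)] by auto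
  qed
  then show ?case by auto
qed (fastforce+)

text \<open>
  The derivation step that a cut-free derivation cannot build into the rule for \<open>\<box>\<close>: replacing
  \<open>A\<close> by \<open>\<not>\<not>A\<close> makes a box out of a formula \<open>A \<rhd> \<bottom>\<close>.
\<close>

lemma derivable_Rhd_Bot_Box_Neg: "derivable c {|Rhd A Bot|} {|Box (Neg A)|}"
proof -
  have "derivable c {||} ({|Neg A|} |\<union>| {|A|})"
    using derivable.negR[of c "{||}" A "{|A|}"] derivable.init[of c A] by simp
  then have dn: "derivable c {|Neg (Neg A)|} {|A|}"
    using derivable.negL[of c "{||}" "Neg A" "{|A|}"] by simp
  show ?thesis
    using derivable.rhd[of c "Neg (Neg A)" "\<lambda>_. A" 1 "\<lambda>_. Bot" Bot] dn derivable.init[of c Bot]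
    by simp
qed

lemma derivable_Box_Box_Box: "derivable c {|Box A|} {|Box (Box A)|}"
proof -
  have "derivable c ({|Box A|} |\<union>| {|A|} |\<union>| {|Box (Box A)|}) {|Box A|}"
    by (intro derivable.wl derivable.init)
  then show ?thesis
    using derivable.box[of c "{|A|}" "Box A"] by simp
qed

lemma provable_Rhd_Bot_Box_Box_Neg: "provable {|Rhd A Bot|} {|Box (Box (Neg A))|}"
  using derivable.cut[of True "{|Rhd A Bot|}" "{||}" "Box (Neg A)" "{||}" "{|Box (Box (Neg A))|}"]
    derivable_Rhd_Bot_Box_Neg derivable_Box_Box_Box by simp

text \<open>
  Antecedent and succedent are allowed to be empty because weakening may drop either formula when
  the derivation is read upwards.
\<close>

lemma not_provable_without_cut_Rhd_Bot_Box_Box_Neg: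
  assumes "provable_without_cut \<Gamma> \<Delta>"
    and "\<Gamma> |\<subseteq>| {|Rhd (Var x) Bot|}" and "\<Delta> |\<subseteq>| {|Box (Box (Neg (Var x)))|}"
  shows False
  using assms
proof (induction rule: derivable.induct)
  case (box \<Gamma> A)
  (* The antecedent is empty: Var x is not a negation, so Rhd (Var x) Bot is not a box. *)
  have "\<Gamma> = {||}"
    using box.prems(1) by auto
  moreover have "A = Box (Neg (Var x))"
    using box.prems(2) by simp
  ultimately have "provable_without_cut {|Box (Box (Neg (Var x)))|} {|Box (Neg (Var x))|}"
    using box.hyps by simp
  (* World 1 sees only world 0, a dead end in which Var x holds. *)
  from soundness[OF this, of "\<lambda>_ m. m = 0" 1] show False by force
next
  case (rhd A X n Y B)
  have A: "A = Neg (Box (Neg (Var x)))"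
    using rhd.prems(2) by simp
  have X: "X i = Var x" if "i < n" for i
    using fsubsetD[OF rhd.prems(1), of "Rhd (X i) (Y i)"] that by (auto simp: fset_of_list_elem)
  (* World 1 satisfies A, since world 0 satisfies Var x, but not Var x itself. *)
  from soundness[OF rhd.hyps(1), of "\<lambda>_ m. m = 0" 1] show False
    by (force simp: A X fset_of_list_elem)
qed auto

theorem corollary3p10:
  shows "\<exists>\<Gamma> \<Delta> :: form fset. provable \<Gamma> \<Delta> \<and> \<not> provable_without_cut \<Gamma> \<Delta>"
  using provable_Rhd_Bot_Box_Box_Neg not_provable_without_cut_Rhd_Bot_Box_Box_Neg by blast

end
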